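(* Let $\mathcal H$ be a separable Hilbert space, let $\Phi=(\varphi_n)_n$ and $\Psi=(\psi_n)_n$ be frames for $\mathcal H$ with (lower, upper) frame bounds $A_\Phi,B_\Phi$ and $A_\Psi,B_\Psi$, respectively, and let $m=(m_n)_n$ be a semi-normalized sequence of complex scalars. Let $\mu>0$ and let $\Phi'=(\varphi'_n)_n$ be a $\mu$-perturbation of $\Phi$, where $\mu<\sqrt{A_\Phi}$. Then there exists a frame $\Psi'=(\psi'_n)_n$ for $\mathcal H$ which is a $\lambda\mu$-perturbation of $\Psi$ for some $\lambda>0$ and which satisfies $$M_{m,\Phi',\Psi'}=M_{m,\Phi,\Psi}.$$ In particular, the operator properties of $M_{m,\Phi,\Psi}$ (such as compactness, invertibility, surjectivity, etc.) are stable under such perturbations of $\Phi$, in the sense that $M_{m,\Phi',\Psi'}$ has the same operator properties as $M_{m,\Phi,\Psi}$.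
   Context: Sequences are indexed by $n\in\mathbb N$. For a Bessel sequence $\Phi=(\varphi_n)_n$ in $\mathcal H$, the analysis operator is $U_\Phi:\mathcal H\to\ell^2$, $U_\Phi f=(\langle f,\varphi_n\rangle)_n$, and the synthesis operator is $T_\Phi:\ell^2\to\mathcal H$, $T_\Phi(c_n)_n=\sum_n c_n\varphi_n$. For $m\in\ell^\infty$, $\mathcal M_m:\ell^2\to\ell^2$ is $\mathcal M_m(c_n)_n=(m_nc_n)_n$, and the multiplier with symbol $m$ is $M_{m,\Phi,\Psi}=T_\Phi\mathcal M_mU_\Psi$, i.e. $M_{m,\Phi,\Psi}f=\sum_{n=1}^\infty m_n\langle f,\psi_n\rangle\varphi_n$. A complex sequence $m$ is semi-normalized if $0<\inf_n|m_n|\le\sup_n|m_n|<\infty$. For $\mu>0$, a sequence $\Phi'$ in $\mathcal H$ is a $\mu$-perturbation of $\Phi$ if $\|T_\Phi-T_{\Phi'}\|\le\mu$. *)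

theory Defs
  imports "HOL-Analysis.Analysis"
begin

section \<open>Complex Hilbert spaces\<close>

class scaleC =
  fixes scaleC :: "complex \<Rightarrow> 'a \<Rightarrow> 'a"  (infixr \<open>*\<^sub>C\<close> 75)

text \<open>The inner product is linear in its first argument. Positive definiteness is contained
  in \<open>cinner_self\<close>, since the norm of a \<^class>\<open>real_normed_vector\<close> is.\<close>

class complex_inner = real_normed_vector + scaleC +
  fixes cinner :: "'a \<Rightarrow> 'a \<Rightarrow> complex"
  assumes scaleC_of_real: "complex_of_real r *\<^sub>C x = r *\<^sub>R x"
    and scaleC_add_right: "a *\<^sub>C (x + y) = a *\<^sub>C x + a *\<^sub>C y"
    and scaleC_add_left: "(a + b) *\<^sub>C x = a *\<^sub>C x + b *\<^sub>C x"
    and scaleC_scaleC: "a *\<^sub>C b *\<^sub>C x = (a * b) *\<^sub>C x"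
    and cinner_commute: "cinner x y = cnj (cinner y x)"
    and cinner_add_left: "cinner (x + y) z = cinner x z + cinner y z"
    and cinner_scaleC_left: "cinner (a *\<^sub>C x) y = a * cinner x y"
    and cinner_self: "cinner x x = complex_of_real ((norm x)\<^sup>2)"

class chilbert_space = complex_inner + complete_space

definition bounded_clinear :: "('a::complex_inner \<Rightarrow> 'b::complex_inner) \<Rightarrow> bool" where
  "bounded_clinear T \<longleftrightarrow> bounded_linear T \<and> (\<forall>a x. T (a *\<^sub>C x) = a *\<^sub>C T x)"

definition compact_operator :: "('a::complex_inner \<Rightarrow> 'b::complex_inner) \<Rightarrow> bool" where
  "compact_operator T \<longleftrightarrow> bounded_clinear T \<and> compact (closure (T ` cball 0 1))"

definition invertible_operator :: "('a::complex_inner \<Rightarrow> 'b::complex_inner) \<Rightarrow> bool" where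
  "invertible_operator T \<longleftrightarrow>
     bounded_clinear T \<and> (\<exists>S. bounded_clinear S \<and> S \<circ> T = id \<and> T \<circ> S = id)"


section \<open>The Hilbert space of square-summable sequences\<close>

typedef ell2 = "{c :: nat \<Rightarrow> complex. summable (\<lambda>n. (cmod (c n))\<^sup>2)}"
  morphisms ell2_nth ell2_of
  by (rule exI[of _ "\<lambda>_. 0"]) simp

setup_lifting type_definition_ell2

lemma ell2_add_aux:
  fixes c d :: "nat \<Rightarrow> complex"
  assumes "summable (\<lambda>n. (cmod (c n))\<^sup>2)" "summable (\<lambda>n. (cmod (d n))\<^sup>2)"
  shows "summable (\<lambda>n. (cmod (c n + d n))\<^sup>2)"
proof (rule summable_comparison_test')
  show "summable (\<lambda>n. 2 * (cmod (c n))\<^sup>2 + 2 * (cmod (d n))\<^sup>2)"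
    using assms by (intro summable_add summable_mult)
  fix n
  have "(cmod (c n + d n))\<^sup>2 \<le> (cmod (c n) + cmod (d n))\<^sup>2"
    by (intro power_mono norm_triangle_ineq) auto
  also have "\<dots> \<le> 2 * (cmod (c n))\<^sup>2 + 2 * (cmod (d n))\<^sup>2"
    using sum_squares_bound[of "cmod (c n)" "cmod (d n)"]
    by (simp add: power2_sum)
  finally show "norm ((cmod (c n + d n))\<^sup>2) \<le> 2 * (cmod (c n))\<^sup>2 + 2 * (cmod (d n))\<^sup>2"
    by simp
qed

lemma ell2_scale_aux:
  fixes c :: "nat \<Rightarrow> complex"
  assumes "summable (\<lambda>n. (cmod (c n))\<^sup>2)"
  shows "summable (\<lambda>n. (cmod (a * c n))\<^sup>2)"
  using summable_mult[OF assms, of "(cmod a)\<^sup>2"] by (simp add: norm_mult power_mult_distrib)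

lemma ell2_mult_aux:
  fixes c d :: "nat \<Rightarrow> complex"
  assumes "summable (\<lambda>n. (cmod (c n))\<^sup>2)" "summable (\<lambda>n. (cmod (d n))\<^sup>2)"
  shows "summable (\<lambda>n. c n * cnj (d n))"
proof (rule summable_comparison_test')
  show "summable (\<lambda>n. (cmod (c n))\<^sup>2 + (cmod (d n))\<^sup>2)"
    using assms by (intro summable_add)
  fix n
  show "norm (c n * cnj (d n)) \<le> (cmod (c n))\<^sup>2 + (cmod (d n))\<^sup>2"
  proof -
    have "0 \<le> cmod (c n) * cmod (d n)" by simp
    with sum_squares_bound[of "cmod (c n)" "cmod (d n)"]
    have "cmod (c n) * cmod (d n) \<le> (cmod (c n))\<^sup>2 + (cmod (d n))\<^sup>2" by linarith
    then show ?thesis by (simp add: norm_mult)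
  qed
qed

instantiation ell2 :: complex_inner
begin

lift_definition zero_ell2 :: ell2 is "\<lambda>_. 0" by simp
lift_definition plus_ell2 :: "ell2 \<Rightarrow> ell2 \<Rightarrow> ell2" is "\<lambda>c d n. c n + d n"
  by (rule ell2_add_aux)
lift_definition uminus_ell2 :: "ell2 \<Rightarrow> ell2" is "\<lambda>c n. - c n" by simp
lift_definition minus_ell2 :: "ell2 \<Rightarrow> ell2 \<Rightarrow> ell2" is "\<lambda>c d n. c n - d n"
proof -
  fix c d :: "nat \<Rightarrow> complex"
  assume "summable (\<lambda>n. (cmod (c n))\<^sup>2)" "summable (\<lambda>n. (cmod (d n))\<^sup>2)"
  then show "summable (\<lambda>n. (cmod (c n - d n))\<^sup>2)"
    using ell2_add_aux[of c "\<lambda>n. - d n"] by simp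
qed
lift_definition scaleR_ell2 :: "real \<Rightarrow> ell2 \<Rightarrow> ell2" is "\<lambda>r c n. complex_of_real r * c n"
  by (rule ell2_scale_aux)
lift_definition scaleC_ell2 :: "complex \<Rightarrow> ell2 \<Rightarrow> ell2" is "\<lambda>a c n. a * c n"
  by (rule ell2_scale_aux)
lift_definition cinner_ell2 :: "ell2 \<Rightarrow> ell2 \<Rightarrow> complex" is "\<lambda>c d. \<Sum>n. c n * cnj (d n)" .
lift_definition norm_ell2 :: "ell2 \<Rightarrow> real" is "\<lambda>c. sqrt (\<Sum>n. (cmod (c n))\<^sup>2)" .
definition sgn_ell2 :: "ell2 \<Rightarrow> ell2" where "sgn_ell2 x = inverse (norm x) *\<^sub>R x"
definition dist_ell2 :: "ell2 \<Rightarrow> ell2 \<Rightarrow> real" where "dist_ell2 x y = norm (x - y)"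
definition uniformity_ell2 :: "(ell2 \<times> ell2) filter" where
  [code del]: "uniformity_ell2 = (INF e\<in>{0 <..}. principal {(x, y). dist x y < e})"
definition open_ell2 :: "ell2 set \<Rightarrow> bool" where
  [code del]: "open_ell2 S = (\<forall>x\<in>S. \<forall>\<^sub>F (x', y) in uniformity. x' = x \<longrightarrow> y \<in> S)"

instance
proof
  fix x y z :: ell2 and r s :: real and a b :: complex
  show "x + y + z = x + (y + z)" "x + y = y + x" "0 + x = x" "- x + x = 0" "x - y = x + - y"
    by (transfer; simp add: algebra_simps)+
  show "r *\<^sub>R (x + y) = r *\<^sub>R x + r *\<^sub>R y" "(r + s) *\<^sub>R x = r *\<^sub>R x + s *\<^sub>R x"
    "r *\<^sub>R s *\<^sub>R x = (r * s) *\<^sub>R x" "1 *\<^sub>R x = x"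
    by (transfer; simp add: algebra_simps)+
  show "dist x y = norm (x - y)" by (rule dist_ell2_def)
  show "sgn x = inverse (norm x) *\<^sub>R x" by (rule sgn_ell2_def)
  show "uniformity = (INF e\<in>{0 <..}. principal {(x::ell2, y). dist x y < e})"
    by (rule uniformity_ell2_def)
  show "open U = (\<forall>x\<in>U. \<forall>\<^sub>F (x', y) in uniformity. x' = x \<longrightarrow> y \<in> U)" for U :: "ell2 set"
    by (rule open_ell2_def)
  show "(norm x = 0) = (x = 0)"
    by transfer (auto simp: suminf_eq_zero_iff)
  show "norm (x + y) \<le> norm x + norm y"
  proof transfer
    fix c d :: "nat \<Rightarrow> complex"
    assume c: "summable (\<lambda>n. (cmod (c n))\<^sup>2)" and d: "summable (\<lambda>n. (cmod (d n))\<^sup>2)"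
    have lim: "(\<lambda>N. L2_set (\<lambda>n. cmod (u n)) {..<N}) \<longlonglongrightarrow> sqrt (\<Sum>n. (cmod (u n))\<^sup>2)"
      if "summable (\<lambda>n. (cmod (u n))\<^sup>2)" for u :: "nat \<Rightarrow> complex"
      unfolding L2_set_def by (intro tendsto_real_sqrt summable_LIMSEQ that)
    have "L2_set (\<lambda>n. cmod (c n + d n)) {..<N}
        \<le> L2_set (\<lambda>n. cmod (c n)) {..<N} + L2_set (\<lambda>n. cmod (d n)) {..<N}" for N
      by (rule order_trans[OF L2_set_mono L2_set_triangle_ineq]) (auto intro: norm_triangle_ineq)
    then show "sqrt (\<Sum>n. (cmod (c n + d n))\<^sup>2)
        \<le> sqrt (\<Sum>n. (cmod (c n))\<^sup>2) + sqrt (\<Sum>n. (cmod (d n))\<^sup>2)"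
      by (intro LIMSEQ_le[OF lim[OF ell2_add_aux[OF c d]] tendsto_add[OF lim[OF c] lim[OF d]]]) auto
  qed
  show "norm (r *\<^sub>R x) = \<bar>r\<bar> * norm x"
    by transfer (simp add: norm_mult power_mult_distrib suminf_mult real_sqrt_mult)
  show "complex_of_real r *\<^sub>C x = r *\<^sub>R x" "a *\<^sub>C (x + y) = a *\<^sub>C x + a *\<^sub>C y"
    "(a + b) *\<^sub>C x = a *\<^sub>C x + b *\<^sub>C x" "a *\<^sub>C b *\<^sub>C x = (a * b) *\<^sub>C x"
    by (transfer; simp add: algebra_simps)+
  show "cinner x y = cnj (cinner y x)"
  proof transfer
    fix c d :: "nat \<Rightarrow> complex"
    assume c: "summable (\<lambda>n. (cmod (c n))\<^sup>2)" and d: "summable (\<lambda>n. (cmod (d n))\<^sup>2)"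
    have "(\<lambda>n. cnj (d n * cnj (c n))) sums cnj (\<Sum>n. d n * cnj (c n))"
      by (subst sums_cnj) (intro summable_sums ell2_mult_aux c d)
    then show "(\<Sum>n. c n * cnj (d n)) = cnj (\<Sum>n. d n * cnj (c n))"
      by (simp add: sums_iff mult.commute)
  qed
  show "cinner (x + y) z = cinner x z + cinner y z"
    by transfer (simp add: distrib_right suminf_add ell2_mult_aux)
  show "cinner (a *\<^sub>C x) y = a * cinner x y"
    by transfer (simp add: suminf_mult ell2_mult_aux mult.assoc)
  show "cinner x x = complex_of_real ((norm x)\<^sup>2)"
  proof transfer
    fix c :: "nat \<Rightarrow> complex"
    assume c: "summable (\<lambda>n. (cmod (c n))\<^sup>2)"
    have "(\<Sum>n. c n * cnj (c n)) = (\<Sum>n. complex_of_real ((cmod (c n))\<^sup>2))"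
      by (simp only: complex_norm_square)
    also have "\<dots> = complex_of_real (\<Sum>n. (cmod (c n))\<^sup>2)"
      by (rule suminf_of_real[OF c, symmetric])
    also have "(\<Sum>n. (cmod (c n))\<^sup>2) = (sqrt (\<Sum>n. (cmod (c n))\<^sup>2))\<^sup>2"
      using suminf_nonneg[OF c] by simp
    finally show "(\<Sum>n. c n * cnj (c n)) = complex_of_real ((sqrt (\<Sum>n. (cmod (c n))\<^sup>2))\<^sup>2)" .
  qed
qed

end

lemma norm_ell2_nth_le: "cmod (ell2_nth x n) \<le> norm x"
proof transfer
  fix c :: "nat \<Rightarrow> complex" and n
  assume "summable (\<lambda>n. (cmod (c n))\<^sup>2)"
  then have "sum (\<lambda>n. (cmod (c n))\<^sup>2) {n} \<le> (\<Sum>n. (cmod (c n))\<^sup>2)"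
    by (intro sum_le_suminf) auto
  then show "cmod (c n) \<le> sqrt (\<Sum>n. (cmod (c n))\<^sup>2)"
    by (simp add: real_le_rsqrt)
qed

instance ell2 :: chilbert_space
proof
  fix X :: "nat \<Rightarrow> ell2"
  assume X: "Cauchy X"
  have nth_diff: "ell2_nth (x - y) n = ell2_nth x n - ell2_nth y n" for x y n
    by transfer simp
  have norm_def: "(norm x)\<^sup>2 = (\<Sum>n. (cmod (ell2_nth x n))\<^sup>2)" for x
    by transfer (simp add: suminf_nonneg)
  have summ: "summable (\<lambda>n. (cmod (ell2_nth x n))\<^sup>2)" for x
    using ell2_nth[of x] by simp
  have "convergent (\<lambda>k. ell2_nth (X k) n)" for n
    unfolding Cauchy_convergent_iff[symmetric]
  proof (rule metric_CauchyI)
    fix e :: real assume "e > 0"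
    from metric_CauchyD[OF X this] obtain M where
      M: "dist (X j) (X k) < e" if "j \<ge> M" "k \<ge> M" for j k by blast
    have "dist (ell2_nth (X j) n) (ell2_nth (X k) n) < e" if "j \<ge> M" "k \<ge> M" for j k
    proof -
      have "dist (ell2_nth (X j) n) (ell2_nth (X k) n) \<le> dist (X j) (X k)"
        using norm_ell2_nth_le[of "X j - X k" n] by (simp add: dist_norm nth_diff)
      then show ?thesis using M[OF that] by simp
    qed
    then show "\<exists>M. \<forall>j\<ge>M. \<forall>k\<ge>M. dist (ell2_nth (X j) n) (ell2_nth (X k) n) < e"
      by blast
  qed
  then obtain c where c: "(\<lambda>k. ell2_nth (X k) n) \<longlonglongrightarrow> c n" for n
    unfolding convergent_def by metis
  have fin: "\<exists>M. \<forall>k\<ge>M. \<forall>N. (\<Sum>n<N. (cmod (ell2_nth (X k) n - c n))\<^sup>2) \<le> e\<^sup>2" if "e > 0" for e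
  proof -
    from metric_CauchyD[OF X that] obtain M where
      M: "dist (X j) (X k) < e" if "j \<ge> M" "k \<ge> M" for j k by blast
    have "(\<Sum>n<N. (cmod (ell2_nth (X k) n - c n))\<^sup>2) \<le> e\<^sup>2" if "k \<ge> M" for k N
    proof (rule tendsto_upperbound)
      show "(\<lambda>j. \<Sum>n<N. (cmod (ell2_nth (X k) n - ell2_nth (X j) n))\<^sup>2)
          \<longlonglongrightarrow> (\<Sum>n<N. (cmod (ell2_nth (X k) n - c n))\<^sup>2)"
        by (intro tendsto_intros c)
      show "\<forall>\<^sub>F j in sequentially. (\<Sum>n<N. (cmod (ell2_nth (X k) n - ell2_nth (X j) n))\<^sup>2) \<le> e\<^sup>2"
      proof (rule eventually_sequentiallyI[of M])
        fix j assume "j \<ge> M"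
        have "(\<Sum>n<N. (cmod (ell2_nth (X k - X j) n))\<^sup>2) \<le> (norm (X k - X j))\<^sup>2"
          unfolding norm_def by (intro sum_le_suminf summ) auto
        also have "\<dots> \<le> e\<^sup>2"
          using M[OF \<open>k \<ge> M\<close> \<open>j \<ge> M\<close>] by (intro power_mono) (auto simp: dist_norm)
        finally show "(\<Sum>n<N. (cmod (ell2_nth (X k) n - ell2_nth (X j) n))\<^sup>2) \<le> e\<^sup>2"
          by (simp add: nth_diff)
      qed
    qed simp
    then show ?thesis by blast
  qed
  have "summable (\<lambda>n. (cmod (c n))\<^sup>2)"
  proof -
    from fin[of 1] obtain k where
      k: "\<And>N. (\<Sum>n<N. (cmod (ell2_nth (X k) n - c n))\<^sup>2) \<le> 1" by auto
    have "summable (\<lambda>n. (cmod (ell2_nth (X k) n - c n))\<^sup>2)"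
      by (rule summableI_nonneg_bounded[OF _ k]) simp
    then have "summable (\<lambda>n. (cmod (c n - ell2_nth (X k) n))\<^sup>2)"
      by (simp add: norm_minus_commute)
    from ell2_add_aux[OF this summ[of "X k"]] show ?thesis by simp
  qed
  then have l: "ell2_nth (ell2_of c) = c"
    by (simp add: ell2_of_inverse)
  have "X \<longlonglongrightarrow> ell2_of c"
  proof (rule metric_LIMSEQ_I)
    fix e :: real assume "e > 0"
    from fin[of "e / 2"] \<open>e > 0\<close> obtain M where
      M: "\<And>k N. k \<ge> M \<Longrightarrow> (\<Sum>n<N. (cmod (ell2_nth (X k) n - c n))\<^sup>2) \<le> (e / 2)\<^sup>2" by auto
    have "dist (X k) (ell2_of c) < e" if "k \<ge> M" for k
    proof -
      have "(norm (X k - ell2_of c))\<^sup>2 \<le> (e / 2)\<^sup>2"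
        unfolding norm_def by (intro suminf_le_const summ) (auto simp: nth_diff l M that)
      then have "norm (X k - ell2_of c) \<le> e / 2"
        by (rule power2_le_imp_le) (use \<open>e > 0\<close> in simp)
      then show ?thesis using \<open>e > 0\<close> by (simp add: dist_norm)
    qed
    then show "\<exists>M. \<forall>k\<ge>M. dist (X k) (ell2_of c) < e" by blast
  qed
  then show "convergent X" by (rule convergentI)
qed


section \<open>Frames and multipliers\<close>

text \<open>Sequences are indexed by \<^typ>\<open>nat\<close>, that is, from \<open>0\<close>. Summability is required
  explicitly because \<^const>\<open>suminf\<close> is also defined for divergent series.\<close>

definition bessel :: "(nat \<Rightarrow> 'h::complex_inner) \<Rightarrow> bool" where
  "bessel \<Phi> \<longleftrightarrow> (\<exists>B>0. \<forall>f. summable (\<lambda>n. (cmod (cinner f (\<Phi> n)))\<^sup>2) \<and>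
     (\<Sum>n. (cmod (cinner f (\<Phi> n)))\<^sup>2) \<le> B * (norm f)\<^sup>2)"

definition frame_bounds :: "(nat \<Rightarrow> 'h::complex_inner) \<Rightarrow> real \<Rightarrow> real \<Rightarrow> bool" where
  "frame_bounds \<Phi> A B \<longleftrightarrow> 0 < A \<and> 0 < B \<and>
     (\<forall>f. summable (\<lambda>n. (cmod (cinner f (\<Phi> n)))\<^sup>2) \<and>
       A * (norm f)\<^sup>2 \<le> (\<Sum>n. (cmod (cinner f (\<Phi> n)))\<^sup>2) \<and>
       (\<Sum>n. (cmod (cinner f (\<Phi> n)))\<^sup>2) \<le> B * (norm f)\<^sup>2)"

definition frame :: "(nat \<Rightarrow> 'h::complex_inner) \<Rightarrow> bool" where
  "frame \<Phi> \<longleftrightarrow> (\<exists>A B. frame_bounds \<Phi> A B)"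

text \<open>The next four operators are meaningful when \<open>\<Phi>\<close>, \<open>\<Psi>\<close> are Bessel sequences and \<open>m\<close> is
  bounded: then the arguments of \<^const>\<open>ell2_of\<close> are square-summable and the series converges.\<close>

definition analysis :: "(nat \<Rightarrow> 'h::complex_inner) \<Rightarrow> 'h \<Rightarrow> ell2" where
  "analysis \<Phi> f = ell2_of (\<lambda>n. cinner f (\<Phi> n))"

definition synthesis :: "(nat \<Rightarrow> 'h::complex_inner) \<Rightarrow> ell2 \<Rightarrow> 'h" where
  "synthesis \<Phi> c = (\<Sum>n. ell2_nth c n *\<^sub>C \<Phi> n)"

definition diag_mult :: "(nat \<Rightarrow> complex) \<Rightarrow> ell2 \<Rightarrow> ell2" where
  "diag_mult m c = ell2_of (\<lambda>n. m n * ell2_nth c n)"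

definition multiplier ::
  "(nat \<Rightarrow> complex) \<Rightarrow> (nat \<Rightarrow> 'h::complex_inner) \<Rightarrow> (nat \<Rightarrow> 'h) \<Rightarrow> 'h \<Rightarrow> 'h" where
  "multiplier m \<Phi> \<Psi> = synthesis \<Phi> \<circ> diag_mult m \<circ> analysis \<Psi>"

lemma multiplier_apply:
  assumes "bdd_above (range (\<lambda>n. cmod (m n)))" "bessel \<Psi>"
  shows "multiplier m \<Phi> \<Psi> f = (\<Sum>n. (m n * cinner f (\<Psi> n)) *\<^sub>C \<Phi> n)"
proof -
  from assms(1) obtain K where K: "cmod (m n) \<le> K" for n
    by (auto simp: bdd_above_def)
  have f: "summable (\<lambda>n. (cmod (cinner f (\<Psi> n)))\<^sup>2)"
    using assms(2) by (auto simp: bessel_def)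
  have mf: "summable (\<lambda>n. (cmod (m n * cinner f (\<Psi> n)))\<^sup>2)"
  proof (rule summable_comparison_test')
    show "summable (\<lambda>n. K\<^sup>2 * (cmod (cinner f (\<Psi> n)))\<^sup>2)" by (intro summable_mult f)
    show "norm ((cmod (m n * cinner f (\<Psi> n)))\<^sup>2) \<le> K\<^sup>2 * (cmod (cinner f (\<Psi> n)))\<^sup>2" for n
      using power_mono[OF K[of n] norm_ge_zero, of 2]
      by (simp add: norm_mult power_mult_distrib mult_right_mono)
  qed
  from f mf show ?thesis
    by (simp add: multiplier_def synthesis_def diag_mult_def analysis_def ell2_of_inverse)
qed

definition semi_normalized :: "(nat \<Rightarrow> complex) \<Rightarrow> bool" where
  "semi_normalized m \<longleftrightarrow>
     0 < (INF n. cmod (m n)) \<and> bdd_above (range (\<lambda>n. cmod (m n)))"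

text \<open>The Bessel conditions say that both synthesis operators are defined (and bounded) on all of
  \<^typ>\<open>ell2\<close>, so that the operator norm \<^const>\<open>onorm\<close> is that of a bounded operator.\<close>

definition perturbation :: "real \<Rightarrow> (nat \<Rightarrow> 'h::complex_inner) \<Rightarrow> (nat \<Rightarrow> 'h) \<Rightarrow> bool" where
  "perturbation \<mu> \<Phi> \<Phi>' \<longleftrightarrow> 0 < \<mu> \<and> bessel \<Phi> \<and> bessel \<Phi>' \<and>
     onorm (\<lambda>c. synthesis \<Phi> c - synthesis \<Phi>' c) \<le> \<mu>"

end

theory Submission
  imports Defs
begin

text \<open>A perturbation of \<open>\<Phi>\<close> can be absorbed by an invertible operator on the coefficient space \<open>\<ell>\<^sup>2\<close>.
  Write \<open>T\<close>, \<open>T'\<close> for the synthesis operators of \<open>\<Phi>\<close>, \<open>\<Phi>'\<close>, write \<open>U\<close> for the analysis operator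
  of \<open>\<Psi>\<close>, and \<open>D\<close> for the diagonal operator with symbol \<open>m\<close>. The synthesis operator of a frame with
  lower bound \<open>A\<close> has a right inverse \<open>R\<close> of norm at most \<open>1 / sqrt A\<close>, the analysis operator of the
  canonical dual frame (\<open>frame_synthesis_right_inverse\<close>). Put \<open>K = R (T - T')\<close>. Then
  \<open>T (I - K) = T - (T - T') = T'\<close>, and \<open>K\<close> has norm at most \<open>\<mu> / sqrt A < 1\<close>, so \<open>I - K\<close> has a
  bounded right inverse \<open>L\<close> (\<open>contraction_right_inverse\<close>) and \<open>T' L = T (I - K) L = T\<close>.

  The multiplier of \<open>\<Phi>\<close>, \<open>\<Psi>\<close> is \<open>T D U = T' L D U = T' D V\<close>, where \<open>V = D\<^sup>-\<^sup>1 L D U\<close>; the inverse of \<open>D\<close>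
  is bounded because \<open>m\<close> is bounded away from \<open>0\<close>. It remains to see that \<open>V\<close> is the analysis
  operator of a frame near \<open>\<Psi>\<close>. It is bounded, and bounded below because each of its factors is.
  An operator \<open>V\<close> into \<open>\<ell>\<^sup>2\<close> with adjoint \<open>W\<close> is the analysis operator of the sequence
  \<open>W e\<^sub>n\<close>, where \<open>e\<^sub>n\<close> is the standard basis (\<open>frame_of_adjoint_pair\<close>).
  Finally \<open>V - U = D\<^sup>-\<^sup>1 (L - I) D U = D\<^sup>-\<^sup>1 K L D U\<close> has norm at most a constant times the norm of \<open>K\<close>,
  hence at most a constant times \<open>\<mu>\<close>, and passing to adjoints turns this into the required
  bound for the synthesis operators.\<close>


section \<open>Inner products\<close>

lemma cinner_add_right: "cinner x (y + z) = cinner x y + cinner x (z :: 'a::complex_inner)"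
  by (metis cinner_commute cinner_add_left complex_cnj_add)

lemma cinner_scaleC_right: "cinner x (a *\<^sub>C y) = cnj a * cinner x (y :: 'a::complex_inner)"
  by (metis cinner_commute cinner_scaleC_left complex_cnj_mult)

lemma cinner_scaleR_left: "cinner (r *\<^sub>R x) y = of_real r * cinner x (y :: 'a::complex_inner)"
  by (metis cinner_scaleC_left scaleC_of_real)

lemma cinner_scaleR_right: "cinner x (r *\<^sub>R y) = of_real r * cinner x (y :: 'a::complex_inner)"
  by (metis cinner_scaleC_right complex_cnj_complex_of_real scaleC_of_real)

lemma cinner_zero_left [simp]: "cinner 0 (y :: 'a::complex_inner) = 0"
  using cinner_scaleR_left[of 0 "0 :: 'a" y] by simp

lemma cinner_zero_right [simp]: "cinner x (0 :: 'a::complex_inner) = 0"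
  using cinner_scaleR_right[of x 0 "0 :: 'a"] by simp

lemma cinner_diff_left: "cinner (x - y) z = cinner x z - cinner y (z :: 'a::complex_inner)"
  using cinner_add_left[of "x - y" y z] by simp

lemma cinner_diff_right: "cinner x (y - z) = cinner x y - cinner x (z :: 'a::complex_inner)"
  using cinner_add_right[of x "y - z" z] by simp

lemma cinner_sum_left: "cinner (sum g F) (y :: 'a::complex_inner) = (\<Sum>k\<in>F. cinner (g k) y)"
  by (induction F rule: infinite_finite_induct) (auto simp: cinner_add_left)

lemma cinner_eqI: "x = (y :: 'a::complex_inner)" if "\<And>z. cinner x z = cinner y z"
  using cinner_self[of "x - y"] that[of "x - y"] by (simp add: cinner_diff_left)

lemma power2_norm_eq_Re_cinner: "(norm (x :: 'a::complex_inner))\<^sup>2 = Re (cinner x x)"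
  by (simp add: cinner_self)

lemma power2_norm_diff:
  "(norm (x - y))\<^sup>2 = (norm x)\<^sup>2 - 2 * Re (cinner y x) + (norm (y :: 'a::complex_inner))\<^sup>2"
  by (simp add: power2_norm_eq_Re_cinner cinner_diff_left cinner_diff_right cinner_commute[of x y])

lemma norm_scaleC: "norm (a *\<^sub>C (x :: 'a::complex_inner)) = cmod a * norm x"
proof -
  have "complex_of_real ((norm (a *\<^sub>C x))\<^sup>2) = (a * cnj a) * cinner x x"
    by (simp only: cinner_scaleC_left cinner_scaleC_right mult.assoc mult.left_commute flip: cinner_self)
  also have "\<dots> = complex_of_real ((cmod a * norm x)\<^sup>2)"
    by (simp only: cinner_self power_mult_distrib of_real_mult flip: complex_norm_square)
  finally have "(norm (a *\<^sub>C x))\<^sup>2 = (cmod a * norm x)\<^sup>2" by (simp only: of_real_eq_iff)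
  then show ?thesis by (simp add: power2_eq_iff_nonneg)
qed

lemma cmod_cinner_le: "cmod (cinner x y) \<le> norm x * norm (y :: 'a::complex_inner)"
proof (cases "y = 0")
  case False
  define u where "u = cinner x y"
  define N where "N = (norm y)\<^sup>2"
  have N: "N > 0" using False by (simp add: N_def)
  define a where "a = u / of_real N"
  have "0 \<le> (norm (x - a *\<^sub>C y))\<^sup>2" by simp
  also have "\<dots> = (norm x)\<^sup>2 - 2 * Re (a * cnj u) + (cmod a)\<^sup>2 * N"
    by (simp add: power2_norm_diff cinner_scaleC_left norm_scaleC power_mult_distrib N_def u_def
        cinner_commute[of y x])
  also have "a * cnj u = of_real ((cmod u)\<^sup>2 / N)"
    by (simp only: a_def of_real_divide complex_norm_square times_divide_eq_left)
  also have "(cmod a)\<^sup>2 * N = (cmod u)\<^sup>2 / N"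
    using N by (simp add: a_def norm_divide power2_eq_square)
  finally have "(cmod u)\<^sup>2 \<le> (norm x)\<^sup>2 * N" using N by (simp add: field_simps)
  then have "(cmod u)\<^sup>2 \<le> (norm x * norm y)\<^sup>2" by (simp add: N_def power_mult_distrib)
  then show ?thesis unfolding u_def by (rule power2_le_imp_le) simp
qed simp

lemma bounded_linear_cinner_left: "bounded_linear (\<lambda>x. cinner x (y :: 'a::complex_inner))"
  by (rule bounded_linear_intro[of _ "norm y"])
    (auto simp: cinner_add_left cinner_scaleR_left scaleR_conv_of_real cmod_cinner_le)


section \<open>Adjoint pairs of operators\<close>

text \<open>Every operator below is built from synthesis, analysis and diagonal operators by steps under
  which an adjoint can be written down explicitly. Carrying the adjoint along also makes linearity
  automatic: an operator with an adjoint is linear, by nondegeneracy of the inner product.\<close>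

definition adjoint_pair ::
  "('a::complex_inner \<Rightarrow> 'b::complex_inner) \<Rightarrow> ('b \<Rightarrow> 'a) \<Rightarrow> bool" where
  "adjoint_pair S T \<longleftrightarrow> (\<forall>x y. cinner (S x) y = cinner x (T y))"

lemma adjoint_pairD: "adjoint_pair S T \<Longrightarrow> cinner (S x) y = cinner x (T y)"
  by (simp add: adjoint_pair_def)

lemma adjoint_pair_sym: "adjoint_pair S T \<Longrightarrow> adjoint_pair T S"
  unfolding adjoint_pair_def by (metis cinner_commute)

lemma adjoint_pair_comp:
  "adjoint_pair S T \<Longrightarrow> adjoint_pair S' T' \<Longrightarrow> adjoint_pair (\<lambda>x. S (S' x)) (\<lambda>y. T' (T y))"
  by (simp add: adjoint_pair_def)

lemma adjoint_pair_diff: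
  "adjoint_pair S T \<Longrightarrow> adjoint_pair S' T' \<Longrightarrow>
    adjoint_pair (\<lambda>x. S x - S' x) (\<lambda>y. T y - T' y)"
  by (simp add: adjoint_pair_def cinner_diff_left cinner_diff_right)

lemma adjoint_pair_diff_scaleR:
  "adjoint_pair S T \<Longrightarrow> adjoint_pair (\<lambda>x. x - r *\<^sub>R S x) (\<lambda>y. y - r *\<^sub>R T y)"
  by (simp add: adjoint_pair_def cinner_diff_left cinner_diff_right cinner_scaleR_left
      cinner_scaleR_right)

lemma adjoint_pair_imp_add: "adjoint_pair S T \<Longrightarrow> S (x + y) = S x + S y"
  by (rule cinner_eqI) (simp add: adjoint_pair_def cinner_add_left)

lemma adjoint_pair_imp_diff: "adjoint_pair S T \<Longrightarrow> S (x - y) = S x - S y"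
  by (rule cinner_eqI) (simp add: adjoint_pair_def cinner_diff_left)

lemma adjoint_pair_imp_scaleR: "adjoint_pair S T \<Longrightarrow> S (r *\<^sub>R x) = r *\<^sub>R S x"
  by (rule cinner_eqI) (simp add: adjoint_pair_def cinner_scaleR_left)

text \<open>This is the Cauchy--Schwarz inequality applied to \<open>\<parallel>S x\<parallel>\<^sup>2 = \<langle>x, T (S x)\<rangle>\<close>.\<close>

lemma adjoint_pair_norm_le:
  assumes "adjoint_pair S T" and "\<And>y. norm (T y) \<le> C * norm y" and C: "0 \<le> C"
  shows "norm (S x) \<le> C * norm x"
proof (cases "S x = 0")
  case True
  then show ?thesis using C by simp
next
  case False
  have "(norm (S x))\<^sup>2 = cmod (cinner x (T (S x)))"
    by (simp add: cinner_self flip: adjoint_pairD[OF assms(1)] of_real_power)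
  also have "\<dots> \<le> norm x * (C * norm (S x))"
    by (rule order_trans[OF cmod_cinner_le]) (intro mult_left_mono assms norm_ge_zero)
  finally show ?thesis using False by (simp add: power2_eq_square mult.commute)
qed

lemma adjoint_pair_bounded_linear:
  assumes "adjoint_pair S T" and "\<And>x. norm (S x) \<le> C * norm x"
  shows "bounded_linear S"
  by (rule bounded_linear_intro[of _ C])
    (use assms(2) in \<open>auto simp: adjoint_pair_imp_add[OF assms(1)]
      adjoint_pair_imp_scaleR[OF assms(1)] mult.commute\<close>)

lemma adjoint_pair_right_inverses:
  assumes "adjoint_pair S T" "\<And>x. S (S' x) = x" "\<And>y. T (T' y) = y"
  shows "adjoint_pair S' T'"
  unfolding adjoint_pair_def
proof (intro allI)
  fix x y
  have "cinner (S' x) y = cinner (S' x) (T (T' y))" by (simp only: assms(3))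
  also have "\<dots> = cinner (S (S' x)) (T' y)" by (rule adjoint_pairD[OF assms(1), symmetric])
  also have "\<dots> = cinner x (T' y)" by (simp only: assms(2))
  finally show "cinner (S' x) y = cinner x (T' y)" .
qed

text \<open>This is the Neumann series of \<open>I - K\<close>, with Banach's fixed point theorem in place of the
  series: \<open>L x\<close> is the fixed point of the contraction \<open>z \<mapsto> x + K z\<close>. The adjoint of \<open>K\<close> is a contraction
  with the same constant, so the same construction gives the adjoint of \<open>L\<close>.\<close>

lemma contraction_right_inverse:
  fixes K Ks :: "'a::chilbert_space \<Rightarrow> 'a"
  assumes adj: "adjoint_pair K Ks"
    and bd: "\<And>x. norm (K x) \<le> k * norm x" and k: "0 \<le> k" "k < 1"
  shows "\<exists>L Ls. adjoint_pair L Ls \<and> (\<forall>x. L x - K (L x) = x) \<and>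
    (\<forall>x. (1 - k) * norm (L x) \<le> norm x) \<and> (\<forall>x. norm x \<le> (1 + k) * norm (L x))"
proof -
  have ex: "\<exists>L. \<forall>x. L x - Q (L x) = x"
    if Q: "adjoint_pair Q R" "\<And>x. norm (Q x) \<le> k * norm x" for Q R :: "'a \<Rightarrow> 'a"
  proof -
    have "\<exists>z. z - Q z = x" for x
    proof -
      have "\<exists>!z. x + Q z = z"
        by (rule banach_fix_type[OF k])
          (simp add: dist_norm Q(2) flip: adjoint_pair_imp_diff[OF Q(1)])
      then obtain z where "x + Q z = z" by blast
      then show ?thesis by (auto intro!: exI[of _ z] simp: algebra_simps)
    qed
    then show ?thesis by metis
  qed
  have adj': "adjoint_pair Ks K" using adj by (rule adjoint_pair_sym)
  obtain L where L: "\<And>x. L x - K (L x) = x" using ex[OF adj bd] by blast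
  obtain Ls where Ls: "\<And>x. Ls x - Ks (Ls x) = x"
    using ex[OF adj' adjoint_pair_norm_le[OF adj' bd k(1)]] by blast
  have "adjoint_pair (\<lambda>x. x - K x) (\<lambda>x. x - Ks x)"
    using adjoint_pair_diff_scaleR[OF adj, of 1] by simp
  then have "adjoint_pair L Ls"
    by (rule adjoint_pair_right_inverses) (simp_all add: L Ls)
  moreover have "(1 - k) * norm (L x) \<le> norm x" for x
    using norm_triangle_ineq2[of "L x" "K (L x)"] bd[of "L x"] L[of x] by (simp add: algebra_simps)
  moreover have "norm x \<le> (1 + k) * norm (L x)" for x
    using norm_triangle_ineq4[of "L x" "K (L x)"] bd[of "L x"] L[of x] by (simp add: algebra_simps)
  ultimately show ?thesis using L by blast
qed

text \<open>For small \<open>t > 0\<close> the operator \<open>I - t S\<close> is a contraction, because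
  \<open>\<parallel>x - t S x\<parallel>\<^sup>2 \<le> (1 - 2 t A + t\<^sup>2 B\<^sup>2) \<parallel>x\<parallel>\<^sup>2\<close>; hence \<open>t S = I - (I - t S)\<close> has a right inverse
  by \<open>contraction_right_inverse\<close>.\<close>

lemma coercive_right_inverse:
  fixes S :: "'a::chilbert_space \<Rightarrow> 'a"
  assumes adj: "adjoint_pair S S"
    and bd: "\<And>x. norm (S x) \<le> B * norm x" and B: "0 < B"
    and coercive: "\<And>x. A * (norm x)\<^sup>2 \<le> Re (cinner (S x) x)" and A: "0 < A"
  shows "\<exists>R. adjoint_pair R R \<and> (\<forall>x. S (R x) = x)"
proof -
  \<comment> \<open>\<open>A \<le> B\<close> can fail in the zero space, so the bound \<open>B\<close> is enlarged to a \<open>C\<close> with \<open>A < C\<close>.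
    The choice \<open>t = A / C\<^sup>2\<close> minimizes \<open>1 - 2 t A + t\<^sup>2 C\<^sup>2\<close>, with minimum \<open>1 - (A / C)\<^sup>2\<close>.\<close>
  define C where "C = A + B"
  define r where "r = A / C"
  define t where "t = r / C"
  define k where "k = sqrt (1 - r\<^sup>2)"
  have C: "0 < C" "A < C" using A B by (auto simp: C_def)
  have r: "0 < r" "r < 1" using A C by (simp_all add: r_def)
  have t: "0 < t" using r C by (simp add: t_def)
  have tA: "t * A = r\<^sup>2" by (simp add: t_def r_def power2_eq_square)
  have tC: "t\<^sup>2 * C\<^sup>2 = r\<^sup>2" using C by (simp add: t_def power_divide)
  have q: "0 < r\<^sup>2" "r\<^sup>2 < 1"
    using r by (simp_all add: power_less_one_iff)
  have k: "0 \<le> k" "k < 1" using q by (simp_all add: k_def)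
  have contr: "norm (x - t *\<^sub>R S x) \<le> k * norm x" for x
  proof (rule power2_le_imp_le)
    have "norm (S x) \<le> C * norm x"
      using bd[of x] mult_right_mono[of B C "norm x"] A by (simp add: C_def)
    then have "(norm (S x))\<^sup>2 \<le> C\<^sup>2 * (norm x)\<^sup>2"
      using power_mono[of "norm (S x)" "C * norm x" 2] by (simp add: power_mult_distrib)
    then have "t\<^sup>2 * (norm (S x))\<^sup>2 \<le> t\<^sup>2 * (C\<^sup>2 * (norm x)\<^sup>2)"
      by (rule mult_left_mono) simp
    moreover have "t * (A * (norm x)\<^sup>2) \<le> t * Re (cinner (S x) x)"
      using coercive[of x] t by (intro mult_left_mono) auto
    moreover have "(norm (x - t *\<^sub>R S x))\<^sup>2
        = (norm x)\<^sup>2 - 2 * (t * Re (cinner (S x) x)) + t\<^sup>2 * (norm (S x))\<^sup>2"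
      by (simp add: power2_norm_diff cinner_scaleR_left power_mult_distrib)
    ultimately have "(norm (x - t *\<^sub>R S x))\<^sup>2
        \<le> (norm x)\<^sup>2 - 2 * (t * (A * (norm x)\<^sup>2)) + t\<^sup>2 * (C\<^sup>2 * (norm x)\<^sup>2)"
      by linarith
    also have "\<dots> = (1 - r\<^sup>2) * (norm x)\<^sup>2"
      by (simp add: left_diff_distrib tA tC flip: mult.assoc)
    also have "\<dots> = (k * norm x)\<^sup>2"
      using q by (simp add: k_def power_mult_distrib)
    finally show "(norm (x - t *\<^sub>R S x))\<^sup>2 \<le> (k * norm x)\<^sup>2" .
  qed (use k in simp)
  have "adjoint_pair (\<lambda>x. x - t *\<^sub>R S x) (\<lambda>x. x - t *\<^sub>R S x)"
    by (rule adjoint_pair_diff_scaleR[OF adj])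
  from contraction_right_inverse[OF this contr k]
  obtain L where L: "\<And>x. L x - (L x - t *\<^sub>R S (L x)) = x" by blast
  have inv: "S (t *\<^sub>R L x) = x" for x
    using L[of x] by (simp add: adjoint_pair_imp_scaleR[OF adj])
  show ?thesis
    using adjoint_pair_right_inverses[OF adj inv inv] inv by blast
qed


section \<open>Square-summable sequences\<close>

lemma summable_ell2_nth: "summable (\<lambda>n. (cmod (ell2_nth c n))\<^sup>2)"
  using ell2_nth[of c] by simp

lemma power2_norm_ell2: "(norm c)\<^sup>2 = (\<Sum>n. (cmod (ell2_nth c n))\<^sup>2)"
  by transfer (simp add: suminf_nonneg)

lemma cinner_ell2: "cinner c d = (\<Sum>n. ell2_nth c n * cnj (ell2_nth d n))"
  by transfer simp

lemma ell2_eqI: "(\<And>n. ell2_nth c n = ell2_nth d n) \<Longrightarrow> c = d"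
  by (metis ell2_nth_inject ext)

lift_definition ell2_basis :: "nat \<Rightarrow> ell2" is "\<lambda>n k. if k = n then 1 else 0"
  by (rule summable_finite[of "{n}" for n]) auto

lemma cinner_ell2_basis: "cinner c (ell2_basis n) = ell2_nth c n"
proof transfer
  fix c :: "nat \<Rightarrow> complex" and n
  have "(\<Sum>k. c k * cnj (if k = n then 1 else 0)) = (\<Sum>k\<in>{n}. c k * cnj (if k = n then 1 else 0))"
    by (rule suminf_finite) auto
  then show "(\<Sum>k. c k * cnj (if k = n then 1 else 0)) = c n" by simp
qed

context
  fixes m :: "nat \<Rightarrow> complex" and b :: real
  assumes b: "\<And>n. cmod (m n) \<le> b"
begin

lemma summable_diag_mult:
  "summable (\<lambda>n. (cmod (m n * ell2_nth c n))\<^sup>2)"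
  "(\<Sum>n. (cmod (m n * ell2_nth c n))\<^sup>2) \<le> b\<^sup>2 * (norm c)\<^sup>2"
proof -
  have *: "(cmod (m n * ell2_nth c n))\<^sup>2 \<le> b\<^sup>2 * (cmod (ell2_nth c n))\<^sup>2" for n
    using power_mono[OF b[of n], of 2]
    by (simp add: norm_mult power_mult_distrib mult_right_mono)
  have s: "summable (\<lambda>n. b\<^sup>2 * (cmod (ell2_nth c n))\<^sup>2)"
    by (intro summable_mult summable_ell2_nth)
  show 1: "summable (\<lambda>n. (cmod (m n * ell2_nth c n))\<^sup>2)"
    by (rule summable_comparison_test'[OF s]) (use * in simp)
  show "(\<Sum>n. (cmod (m n * ell2_nth c n))\<^sup>2) \<le> b\<^sup>2 * (norm c)\<^sup>2"
    using suminf_le[OF * 1 s] by (simp add: suminf_mult summable_ell2_nth power2_norm_ell2)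
qed

lemma ell2_nth_diag_mult: "ell2_nth (diag_mult m c) n = m n * ell2_nth c n"
  by (simp add: diag_mult_def ell2_of_inverse summable_diag_mult)

lemma norm_diag_mult_le: "norm (diag_mult m c) \<le> b * norm c"
proof (rule power2_le_imp_le)
  show "(norm (diag_mult m c))\<^sup>2 \<le> (b * norm c)\<^sup>2"
    by (simp add: power2_norm_ell2[of "diag_mult m c"] ell2_nth_diag_mult summable_diag_mult
        power_mult_distrib)
  show "0 \<le> b * norm c" using order_trans[OF norm_ge_zero b] by simp
qed

end

lemma adjoint_pair_diag_mult:
  assumes "\<And>n. cmod (m n) \<le> b"
  shows "adjoint_pair (diag_mult m) (diag_mult (\<lambda>n. cnj (m n)))"
  using assms
  by (simp add: adjoint_pair_def cinner_ell2 ell2_nth_diag_mult[of m b]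
      ell2_nth_diag_mult[of "\<lambda>n. cnj (m n)" b] mult_ac)


text \<open>Summability of vector-valued series is characterized by the Cauchy condition in the
  class \<^class>\<open>banach\<close>.\<close>

instance chilbert_space \<subseteq> banach ..


section \<open>Analysis and synthesis operators\<close>

lemma frame_bounds_imp_bessel: "frame_bounds \<Phi> A B \<Longrightarrow> bessel \<Phi>"
  by (auto simp: frame_bounds_def bessel_def)

lemma ell2_nth_analysis: "bessel \<Phi> \<Longrightarrow> ell2_nth (analysis \<Phi> f) n = cinner f (\<Phi> n)"
  by (auto simp: bessel_def analysis_def ell2_of_inverse)

lemma power2_norm_analysis:
  "bessel \<Phi> \<Longrightarrow> (norm (analysis \<Phi> f))\<^sup>2 = (\<Sum>n. (cmod (cinner f (\<Phi> n)))\<^sup>2)"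
  by (simp add: power2_norm_ell2 ell2_nth_analysis)

lemma frame_bounds_analysis:
  assumes "frame_bounds \<Phi> A B"
  shows "sqrt A * norm f \<le> norm (analysis \<Phi> f)" "norm (analysis \<Phi> f) \<le> sqrt B * norm f"
proof -
  have "A * (norm f)\<^sup>2 \<le> (norm (analysis \<Phi> f))\<^sup>2" "(norm (analysis \<Phi> f))\<^sup>2 \<le> B * (norm f)\<^sup>2"
    using assms by (simp_all add: power2_norm_analysis[OF frame_bounds_imp_bessel[OF assms]]
        frame_bounds_def)
  from this[THEN real_sqrt_le_mono]
  show "sqrt A * norm f \<le> norm (analysis \<Phi> f)" "norm (analysis \<Phi> f) \<le> sqrt B * norm f"
    by (simp_all add: real_sqrt_mult)
qed

text \<open>A finite block \<open>s\<close> of the series satisfies \<open>\<parallel>s\<parallel>\<^sup>2 = \<Sum> c\<^sub>k \<langle>\<phi>\<^sub>k, s\<rangle>\<close>, so by the Cauchy--Schwarz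
  inequality and the Bessel bound for \<open>s\<close> its squared norm is at most \<open>B\<close> times that of the block
  of \<open>c\<close>. Hence the partial sums form a Cauchy sequence.\<close>

lemma synthesis_summable:
  fixes \<Phi> :: "nat \<Rightarrow> 'h::chilbert_space"
  assumes "bessel \<Phi>"
  shows "summable (\<lambda>n. ell2_nth c n *\<^sub>C \<Phi> n)"
proof -
  from assms obtain B where B: "B > 0" "\<And>f. summable (\<lambda>n. (cmod (cinner f (\<Phi> n)))\<^sup>2)"
    "\<And>f. (\<Sum>n. (cmod (cinner f (\<Phi> n)))\<^sup>2) \<le> B * (norm f)\<^sup>2"
    unfolding bessel_def by blast
  have block: "(norm (\<Sum>k\<in>F. ell2_nth c k *\<^sub>C \<Phi> k))\<^sup>2 \<le> B * (\<Sum>k\<in>F. (cmod (ell2_nth c k))\<^sup>2)"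
    if F: "finite F" for F
  proof -
    define s where "s = (\<Sum>k\<in>F. ell2_nth c k *\<^sub>C \<Phi> k)"
    define \<sigma> where "\<sigma> = (\<Sum>k\<in>F. (cmod (ell2_nth c k))\<^sup>2)"
    have "(\<Sum>k\<in>F. (cmod (cinner s (\<Phi> k)))\<^sup>2) \<le> B * (norm s)\<^sup>2"
      by (rule order_trans[OF sum_le_suminf[OF B(2) F] B(3)]) auto
    from real_sqrt_le_mono[OF this]
    have 1: "L2_set (\<lambda>k. cmod (cinner s (\<Phi> k))) F \<le> sqrt B * norm s"
      by (simp add: L2_set_def real_sqrt_mult)
    have "(norm s)\<^sup>2 = cmod (cinner s s)" by (simp add: cinner_self flip: of_real_power)
    also have "cinner s s = (\<Sum>k\<in>F. ell2_nth c k * cnj (cinner s (\<Phi> k)))"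
    proof -
      have "cinner s s = (\<Sum>k\<in>F. cinner (ell2_nth c k *\<^sub>C \<Phi> k) s)"
        unfolding s_def by (rule cinner_sum_left)
      also have "\<dots> = (\<Sum>k\<in>F. ell2_nth c k * cnj (cinner s (\<Phi> k)))"
        by (rule sum.cong[OF refl])
          (simp only: cinner_scaleC_left cinner_commute[of "\<Phi> _" s])
      finally show ?thesis .
    qed
    also have "cmod \<dots> \<le> (\<Sum>k\<in>F. \<bar>cmod (ell2_nth c k)\<bar> * \<bar>cmod (cinner s (\<Phi> k))\<bar>)"
      by (rule order_trans[OF norm_sum]) (simp add: norm_mult)
    also have "\<dots> \<le> sqrt \<sigma> * (sqrt B * norm s)"
      by (rule order_trans[OF L2_set_mult_ineq])
        (unfold \<sigma>_def L2_set_def[of "\<lambda>k. cmod (ell2_nth c k)"],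
          intro mult_left_mono 1 real_sqrt_ge_zero sum_nonneg, simp)
    finally have "norm s * norm s \<le> (sqrt \<sigma> * sqrt B) * norm s"
      by (simp add: power2_eq_square mult.assoc)
    moreover have \<sigma>: "0 \<le> \<sigma>" unfolding \<sigma>_def by (rule sum_nonneg) simp
    ultimately have "norm s \<le> sqrt \<sigma> * sqrt B"
      using B(1) by (cases "norm s = 0") simp_all
    then have "(norm s)\<^sup>2 \<le> (sqrt \<sigma> * sqrt B)\<^sup>2" by (intro power_mono) auto
    also have "\<dots> = B * \<sigma>"
      using B(1) \<sigma> by (simp add: power_mult_distrib)
    finally show ?thesis unfolding s_def \<sigma>_def .
  qed
  show ?thesis
    unfolding summable_Cauchy
  proof (intro allI impI)
    fix e :: real assume e: "e > 0"
    then have "e\<^sup>2 / B > 0" using B(1) by simp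
    then obtain N where N: "\<And>i j. i \<ge> N \<Longrightarrow> norm (\<Sum>k=i..<j. (cmod (ell2_nth c k))\<^sup>2) < e\<^sup>2 / B"
      using summable_ell2_nth[of c] unfolding summable_Cauchy by blast
    have "norm (\<Sum>k=i..<j. ell2_nth c k *\<^sub>C \<Phi> k) < e" if "i \<ge> N" for i j
    proof (rule power_less_imp_less_base[of _ 2])
      have "B * (\<Sum>k=i..<j. (cmod (ell2_nth c k))\<^sup>2) < e\<^sup>2"
        using N[OF that, of j] B(1) by (simp add: sum_nonneg field_simps)
      then show "(norm (\<Sum>k=i..<j. ell2_nth c k *\<^sub>C \<Phi> k))\<^sup>2 < e\<^sup>2"
        using block[of "{i..<j}"] by simp
    qed (use e in simp)
    then show "\<exists>N. \<forall>i\<ge>N. \<forall>j. norm (\<Sum>k=i..<j. ell2_nth c k *\<^sub>C \<Phi> k) < e" by blast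
  qed
qed

lemma adjoint_pair_synthesis_analysis:
  fixes \<Phi> :: "nat \<Rightarrow> 'h::chilbert_space"
  assumes "bessel \<Phi>"
  shows "adjoint_pair (synthesis \<Phi>) (analysis \<Phi>)"
  unfolding adjoint_pair_def
proof (intro allI)
  fix c f
  have "cinner (synthesis \<Phi> c) f = (\<Sum>n. cinner (ell2_nth c n *\<^sub>C \<Phi> n) f)"
    unfolding synthesis_def
    by (rule bounded_linear.suminf[OF bounded_linear_cinner_left synthesis_summable[OF assms]])
  also have "\<dots> = cinner c (analysis \<Phi> f)"
    by (simp add: cinner_ell2 ell2_nth_analysis[OF assms] cinner_scaleC_left cinner_commute[of "\<Phi> _" f])
  finally show "cinner (synthesis \<Phi> c) f = cinner c (analysis \<Phi> f)" .
qed

lemma bessel_analysis_bounded: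
  assumes "bessel \<Phi>"
  obtains C where "0 \<le> C" "\<And>f. norm (analysis \<Phi> f) \<le> C * norm f"
proof -
  from assms obtain B where B: "B > 0" "\<And>f. (\<Sum>n. (cmod (cinner f (\<Phi> n)))\<^sup>2) \<le> B * (norm f)\<^sup>2"
    unfolding bessel_def by blast
  have "norm (analysis \<Phi> f) \<le> sqrt B * norm f" for f
    using real_sqrt_le_mono[OF B(2)[of f]]
    by (simp add: real_sqrt_mult flip: power2_norm_analysis[OF assms])
  then show ?thesis using that[of "sqrt B"] B(1) by simp
qed

text \<open>The operator norm yields pointwise bounds only for bounded operators. Boundedness of the two
  synthesis operators comes from the Bessel bounds of their adjoints, the analysis operators.\<close>

lemma perturbation_norm_le:
  fixes \<Phi> \<Phi>' :: "nat \<Rightarrow> 'h::chilbert_space"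
  assumes "perturbation \<mu> \<Phi> \<Phi>'"
  shows "norm (synthesis \<Phi> c - synthesis \<Phi>' c) \<le> \<mu> * norm c"
proof -
  have bes: "bessel \<Phi>" "bessel \<Phi>'" and on: "onorm (\<lambda>c. synthesis \<Phi> c - synthesis \<Phi>' c) \<le> \<mu>"
    using assms by (auto simp: perturbation_def)
  have lin: "bounded_linear (synthesis \<Theta>)" if \<Theta>: "bessel \<Theta>" for \<Theta> :: "nat \<Rightarrow> 'h"
  proof -
    obtain C where C: "0 \<le> C" "\<And>f. norm (analysis \<Theta> f) \<le> C * norm f"
      using bessel_analysis_bounded[OF \<Theta>] by blast
    from adjoint_pair_norm_le[OF adjoint_pair_synthesis_analysis[OF \<Theta>] C(2,1)]
    show ?thesis by (rule adjoint_pair_bounded_linear[OF adjoint_pair_synthesis_analysis[OF \<Theta>]])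
  qed
  have "norm (synthesis \<Phi> c - synthesis \<Phi>' c)
      \<le> onorm (\<lambda>c. synthesis \<Phi> c - synthesis \<Phi>' c) * norm c"
    by (rule onorm) (intro bounded_linear_sub lin bes)
  also have "\<dots> \<le> \<mu> * norm c" using on by (rule mult_right_mono) simp
  finally show ?thesis .
qed

text \<open>The distance between two synthesis operators can be estimated on the analysis side, since the
  differences are adjoint to each other.\<close>

lemma perturbationI:
  fixes \<Psi> \<Psi>' :: "nat \<Rightarrow> 'h::chilbert_space"
  assumes "0 < \<mu>" "bessel \<Psi>" "bessel \<Psi>'"
    and "\<And>f. norm (analysis \<Psi> f - analysis \<Psi>' f) \<le> \<mu> * norm f"
  shows "perturbation \<mu> \<Psi> \<Psi>'"
proof -
  have "adjoint_pair (\<lambda>c. synthesis \<Psi> c - synthesis \<Psi>' c) (\<lambda>f. analysis \<Psi> f - analysis \<Psi>' f)"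
    by (intro adjoint_pair_diff adjoint_pair_synthesis_analysis assms)
  from adjoint_pair_norm_le[OF this assms(4) less_imp_le[OF assms(1)]]
  have "onorm (\<lambda>c. synthesis \<Psi> c - synthesis \<Psi>' c) \<le> \<mu>"
    by (rule onorm_bound[OF less_imp_le[OF assms(1)]])
  then show ?thesis using assms by (simp add: perturbation_def)
qed

text \<open>The \<open>n\<close>-th coordinate of \<open>V f\<close> is \<open>\<langle>V f, e\<^sub>n\<rangle> = \<langle>f, W e\<^sub>n\<rangle>\<close>, so operators into \<open>\<ell>\<^sup>2\<close> that have an
  adjoint are analysis operators; bounds for \<open>V\<close> are then frame bounds.\<close>

lemma frame_of_adjoint_pair:
  fixes V :: "'h::chilbert_space \<Rightarrow> ell2"
  assumes adj: "adjoint_pair V W"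
    and lower: "\<And>f. \<alpha> * norm f \<le> norm (V f)" and \<alpha>: "0 < \<alpha>"
    and upper: "\<And>f. norm (V f) \<le> \<beta> * norm f" and \<beta>: "0 < \<beta>"
  shows "frame (\<lambda>n. W (ell2_basis n))" "analysis (\<lambda>n. W (ell2_basis n)) = V"
proof -
  have nth: "cinner f (W (ell2_basis n)) = ell2_nth (V f) n" for f n
    by (simp add: cinner_ell2_basis flip: adjoint_pairD[OF adj])
  show "analysis (\<lambda>n. W (ell2_basis n)) = V"
    by (rule ext) (simp add: analysis_def nth ell2_nth_inverse)
  have "\<alpha>\<^sup>2 * (norm f)\<^sup>2 \<le> (norm (V f))\<^sup>2" "(norm (V f))\<^sup>2 \<le> \<beta>\<^sup>2 * (norm f)\<^sup>2" for f
    using power_mono[OF lower[of f], of 2] power_mono[OF upper[of f], of 2] \<alpha>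
    by (simp_all add: power_mult_distrib)
  then have "frame_bounds (\<lambda>n. W (ell2_basis n)) (\<alpha>\<^sup>2) (\<beta>\<^sup>2)"
    using \<alpha> \<beta> by (simp add: frame_bounds_def nth summable_ell2_nth power2_norm_ell2)
  then show "frame (\<lambda>n. W (ell2_basis n))" by (auto simp: frame_def)
qed

text \<open>Let \<open>S = T U\<close> be the frame operator of \<open>\<Phi>\<close>, with \<open>T\<close> its synthesis and \<open>U\<close> its analysis operator.
  It is coercive, since \<open>\<langle>S f, f\<rangle> = \<parallel>U f\<parallel>\<^sup>2\<close>, so it has a right inverse \<open>Q\<close>, and \<open>R = U Q\<close>. The constant
  comes from \<open>\<parallel>U Q g\<parallel>\<^sup>2 = \<langle>S Q g, Q g\<rangle> = \<langle>g, Q g\<rangle> \<le> \<parallel>g\<parallel> \<parallel>Q g\<parallel>\<close> and \<open>sqrt A \<parallel>Q g\<parallel> \<le> \<parallel>U Q g\<parallel>\<close>. It must be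
  this sharp one because the perturbation is allowed to be arbitrarily close to \<open>sqrt A\<close>.\<close>

lemma frame_synthesis_right_inverse:
  fixes \<Phi> :: "nat \<Rightarrow> 'h::chilbert_space"
  assumes \<Phi>: "frame_bounds \<Phi> A B"
  shows "\<exists>R Rs. adjoint_pair R Rs \<and> (\<forall>g. synthesis \<Phi> (R g) = g) \<and>
    (\<forall>g. sqrt A * norm (R g) \<le> norm g)"
proof -
  define S where "S f = synthesis \<Phi> (analysis \<Phi> f)" for f
  have pos: "0 < A" "0 < B" using \<Phi> by (auto simp: frame_bounds_def)
  have TU: "adjoint_pair (synthesis \<Phi>) (analysis \<Phi>)"
    by (intro adjoint_pair_synthesis_analysis frame_bounds_imp_bessel[OF \<Phi>])
  then have UT: "adjoint_pair (analysis \<Phi>) (synthesis \<Phi>)" by (rule adjoint_pair_sym)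
  note low = frame_bounds_analysis(1)[OF \<Phi>] and up = frame_bounds_analysis(2)[OF \<Phi>]
  have adjS: "adjoint_pair S S"
    unfolding S_def by (rule adjoint_pair_comp[OF TU UT])
  have SU: "cinner (S f) f = complex_of_real ((norm (analysis \<Phi> f))\<^sup>2)" for f
    by (simp add: S_def adjoint_pairD[OF TU] cinner_self)
  have bdS: "norm (S f) \<le> B * norm f" for f
  proof -
    have "norm (S f) \<le> sqrt B * norm (analysis \<Phi> f)"
      unfolding S_def using pos by (intro adjoint_pair_norm_le[OF TU up]) auto
    also have "\<dots> \<le> sqrt B * (sqrt B * norm f)"
      using pos by (intro mult_left_mono up) auto
    also have "\<dots> = B * norm f" using pos by (simp flip: mult.assoc)
    finally show ?thesis .
  qed
  have "A * (norm f)\<^sup>2 \<le> Re (cinner (S f) f)" for f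
    using \<Phi> by (simp add: SU power2_norm_analysis[OF frame_bounds_imp_bessel[OF \<Phi>]]
        frame_bounds_def del: of_real_power)
  from coercive_right_inverse[OF adjS bdS pos(2) this pos(1)]
  obtain Q where Q: "adjoint_pair Q Q" "\<And>g. S (Q g) = g" by blast
  show ?thesis
  proof (intro exI conjI allI)
    show "adjoint_pair (\<lambda>g. analysis \<Phi> (Q g)) (\<lambda>c. Q (synthesis \<Phi> c))"
      by (rule adjoint_pair_comp[OF UT Q(1)])
    show "synthesis \<Phi> (analysis \<Phi> (Q g)) = g" for g using Q(2) by (simp add: S_def)
    show "sqrt A * norm (analysis \<Phi> (Q g)) \<le> norm g" for g
    proof -
      let ?u = "norm (analysis \<Phi> (Q g))"
      have "?u\<^sup>2 = cmod (cinner g (Q g))"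
        using SU[of "Q g"] by (simp add: Q(2) flip: of_real_power)
      also have "\<dots> \<le> norm g * norm (Q g)" by (rule cmod_cinner_le)
      finally have "sqrt A * ?u\<^sup>2 \<le> sqrt A * (norm g * norm (Q g))"
        using pos by (intro mult_left_mono) auto
      also have "\<dots> \<le> norm g * ?u"
        using mult_left_mono[OF low[of "Q g"], of "norm g"] by (simp add: mult_ac)
      finally have "(sqrt A * ?u) * ?u \<le> norm g * ?u" by (simp add: power2_eq_square mult_ac)
      then show ?thesis by (cases "?u = 0") auto
    qed
  qed
qed


section \<open>Perturbing one factor of a multiplier\<close>

lemma semi_normalized_bounds:
  assumes "semi_normalized m"
  obtains a b where "0 < a" "0 < b" "\<And>n. a \<le> cmod (m n)" "\<And>n. cmod (m n) \<le> b"
proof -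
  define a where "a = (INF n. cmod (m n))"
  have a: "0 < a" using assms by (simp add: semi_normalized_def a_def)
  from assms obtain b where b: "\<And>n. cmod (m n) \<le> b"
    by (auto simp: semi_normalized_def bdd_above_def)
  have low: "a \<le> cmod (m n)" for n
    unfolding a_def by (intro cINF_lower bdd_belowI[of _ 0]) auto
  show ?thesis using that[of a b] a b low order.strict_trans2[OF a order_trans[OF low b]] by blast
qed

theorem theorem2p3:
  fixes \<Phi> \<Psi> \<Phi>' :: "nat \<Rightarrow> 'h::chilbert_space"
    and m :: "nat \<Rightarrow> complex"
    and A\<^sub>\<Phi> B\<^sub>\<Phi> A\<^sub>\<Psi> B\<^sub>\<Psi> \<mu> :: real
  assumes "separable_space (euclidean :: 'h topology)"
    and "frame_bounds \<Phi> A\<^sub>\<Phi> B\<^sub>\<Phi>"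
    and "frame_bounds \<Psi> A\<^sub>\<Psi> B\<^sub>\<Psi>"
    and "semi_normalized m"
    and "\<mu> > 0"
    and "perturbation \<mu> \<Phi> \<Phi>'"
    and "\<mu> < sqrt A\<^sub>\<Phi>"
  shows "\<exists>\<Psi>' :: nat \<Rightarrow> 'h.
      frame \<Psi>' \<and>
      (\<exists>lam>0. perturbation (lam * \<mu>) \<Psi> \<Psi>') \<and>
      multiplier m \<Phi>' \<Psi>' = multiplier m \<Phi> \<Psi> \<and>
      (compact_operator (multiplier m \<Phi>' \<Psi>') \<longleftrightarrow> compact_operator (multiplier m \<Phi> \<Psi>)) \<and>
      (invertible_operator (multiplier m \<Phi>' \<Psi>') \<longleftrightarrow> invertible_operator (multiplier m \<Phi> \<Psi>)) \<and>
      (surj (multiplier m \<Phi>' \<Psi>') \<longleftrightarrow> surj (multiplier m \<Phi> \<Psi>)) \<and>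
      (\<forall>P :: ('h \<Rightarrow> 'h) \<Rightarrow> bool. P (multiplier m \<Phi>' \<Psi>') \<longleftrightarrow> P (multiplier m \<Phi> \<Psi>))"
proof -
  let ?T = "synthesis \<Phi>" and ?T' = "synthesis \<Phi>'" and ?U = "analysis \<Psi>"
  define D where "D = diag_mult m"
  define D' where "D' = diag_mult (\<lambda>n. inverse (m n))"
  have bes: "bessel \<Phi>" "bessel \<Phi>'" using assms(6) by (auto simp: perturbation_def)
  have bes\<Psi>: "bessel \<Psi>" using assms(3) by (rule frame_bounds_imp_bessel)
  have pos: "0 < sqrt A\<^sub>\<Psi>" "0 < sqrt B\<^sub>\<Psi>" using assms(3) by (auto simp: frame_bounds_def)
  note low = frame_bounds_analysis(1)[OF assms(3)] and up = frame_bounds_analysis(2)[OF assms(3)]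
  obtain a b where a: "0 < a" and b: "0 < b"
    and am: "\<And>n. a \<le> cmod (m n)" and mb: "\<And>n. cmod (m n) \<le> b"
    using semi_normalized_bounds[OF assms(4)] by blast
  have im: "cmod (inverse (m n)) \<le> inverse a" for n
    using am[of n] a by (simp add: norm_inverse le_imp_inverse_le)
  have nz: "m n \<noteq> 0" for n using am[of n] a by auto
  have D'D: "D' (D c) = c" and DD': "D (D' c) = c" for c
    by (rule ell2_eqI; simp add: D_def D'_def ell2_nth_diag_mult[OF mb] ell2_nth_diag_mult[OF im] nz)+
  have normD: "norm (D c) \<le> b * norm c" and normD': "norm (D' c) \<le> inverse a * norm c" for c
    by (simp_all add: D_def D'_def norm_diag_mult_le[OF mb] norm_diag_mult_le[OF im])
  note adjD = adjoint_pair_diag_mult[of m, OF mb, folded D_def]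
  note adjD' = adjoint_pair_diag_mult[of "\<lambda>n. inverse (m n)", OF im, folded D'_def]

  obtain R Rs where R: "adjoint_pair R Rs" "\<And>g. ?T (R g) = g"
    and normR: "\<And>g. sqrt A\<^sub>\<Phi> * norm (R g) \<le> norm g"
    using frame_synthesis_right_inverse[OF assms(2)] by blast
  define K where "K c = R (?T c - ?T' c)" for c
  define k where "k = \<mu> / sqrt A\<^sub>\<Phi>"
  have s: "0 < sqrt A\<^sub>\<Phi>" using assms(5,7) by linarith
  have k: "0 \<le> k" "k < 1" using assms(5,7) s by (simp_all add: k_def)
  have adjK: "adjoint_pair K (\<lambda>c. analysis \<Phi> (Rs c) - analysis \<Phi>' (Rs c))"
    unfolding K_def
    by (rule adjoint_pair_comp[OF R(1)]) (intro adjoint_pair_diff adjoint_pair_synthesis_analysis bes)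
  have normK: "norm (K c) \<le> k * norm c" for c
    using order_trans[OF normR perturbation_norm_le[OF assms(6), of c]] s
    by (simp add: K_def k_def field_simps)
  obtain L Ls where L: "adjoint_pair L Ls" "\<And>c. L c - K (L c) = c"
    and normL: "\<And>c. (1 - k) * norm (L c) \<le> norm c" "\<And>c. norm c \<le> (1 + k) * norm (L c)"
    using contraction_right_inverse[OF adjK normK k] by blast
  \<comment> \<open>\<open>T K = T - T'\<close>, hence \<open>T = T (I - K) L = T' L\<close>\<close>
  have T'L: "?T' (L c) = ?T c" for c
  proof -
    have "?T c = ?T (L c - K (L c))" by (simp add: L(2))
    also have "\<dots> = ?T (L c) - ?T (K (L c))"
      by (rule adjoint_pair_imp_diff[OF adjoint_pair_synthesis_analysis[OF bes(1)]])
    also have "\<dots> = ?T' (L c)" by (simp add: K_def R(2))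
    finally show ?thesis ..
  qed

  define V where "V f = D' (L (D (?U f)))" for f
  have UT: "adjoint_pair ?U (synthesis \<Psi>)"
    by (rule adjoint_pair_sym[OF adjoint_pair_synthesis_analysis[OF bes\<Psi>]])
  note adjV = adjoint_pair_comp[OF adjD' adjoint_pair_comp[OF L(1) adjoint_pair_comp[OF adjD UT]],
      folded V_def]
  have DV: "D (V f) = L (D (?U f))" for f by (simp add: V_def DD')
  have lowV: "a * sqrt A\<^sub>\<Psi> / ((1 + k) * b) * norm f \<le> norm (V f)" for f
  proof -
    have "a * (sqrt A\<^sub>\<Psi> * norm f) \<le> a * norm (?U f)"
      using a by (intro mult_left_mono low) auto
    also have "\<dots> \<le> norm (D (?U f))"
      using normD'[of "D (?U f)"] a by (simp add: D'D field_simps)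
    also have "\<dots> \<le> (1 + k) * norm (D (V f))" using normL(2) by (simp add: DV)
    also have "\<dots> \<le> (1 + k) * (b * norm (V f))" using k by (intro mult_left_mono normD) auto
    finally have "a * sqrt A\<^sub>\<Psi> * norm f \<le> norm (V f) * ((1 + k) * b)"
      by (simp only: mult_ac)
    moreover have "0 < (1 + k) * b" using b k by simp
    ultimately show ?thesis by (simp only: times_divide_eq_left pos_divide_le_eq)
  qed
  have upD: "norm (D (?U f)) \<le> b * (sqrt B\<^sub>\<Psi> * norm f)" for f
    by (rule order_trans[OF normD mult_left_mono[OF up]]) (use b in simp)
  have upL: "norm (L (D (?U f))) \<le> b * (sqrt B\<^sub>\<Psi> * norm f) / (1 - k)" for f
    using order_trans[OF normL(1) upD[of f]] k by (simp add: field_simps)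
  have upV: "norm (V f) \<le> b * sqrt B\<^sub>\<Psi> / (a * (1 - k)) * norm f" for f
  proof -
    have "norm (V f) \<le> inverse a * (b * (sqrt B\<^sub>\<Psi> * norm f) / (1 - k))"
      unfolding V_def by (rule order_trans[OF normD' mult_left_mono[OF upL]]) (use a in simp)
    then show ?thesis using a k by (simp add: field_simps)
  qed
  define lam where "lam = b * sqrt B\<^sub>\<Psi> / (a * (1 - k) * sqrt A\<^sub>\<Phi>)"
  have "\<mu> = k * sqrt A\<^sub>\<Phi>" using s by (simp add: k_def)
  then have lam_mu: "lam * \<mu> = b * sqrt B\<^sub>\<Psi> / (a * (1 - k)) * k"
    using s by (simp add: lam_def)
  have lam: "lam > 0" using a b k s pos by (simp add: lam_def)
  have diffV: "norm (?U f - V f) \<le> lam * \<mu> * norm f" for f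
  proof -
    have "V f - ?U f = D' (L (D (?U f)) - D (?U f))"
      by (simp add: V_def D'D adjoint_pair_imp_diff[OF adjD'])
    also have "\<dots> = D' (K (L (D (?U f))))"
      using L(2)[of "D (?U f)"] by (metis diff_diff_eq2 add_diff_cancel_left')
    finally have "norm (?U f - V f) = norm (D' (K (L (D (?U f)))))"
      by (metis norm_minus_commute)
    also have "\<dots> \<le> inverse a * (k * (b * (sqrt B\<^sub>\<Psi> * norm f) / (1 - k)))"
      by (rule order_trans[OF normD' mult_left_mono[OF order_trans[OF normK mult_left_mono[OF upL]]]])
        (use a k in auto)
    also have "\<dots> = lam * \<mu> * norm f"
      unfolding lam_mu by (simp add: divide_inverse mult_ac)
    finally show ?thesis .
  qed

  have "0 < a * sqrt A\<^sub>\<Psi> / ((1 + k) * b)" "0 < b * sqrt B\<^sub>\<Psi> / (a * (1 - k))"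
    using a b k pos by simp_all
  note frame_of_adjoint_pair[OF adjV lowV this(1) upV this(2)]
  then obtain \<Psi>' :: "nat \<Rightarrow> 'h" where \<Psi>': "frame \<Psi>'" "analysis \<Psi>' = V"
    by blast
  have "bessel \<Psi>'" using \<Psi>'(1) frame_bounds_imp_bessel by (auto simp: frame_def)
  then have "perturbation (lam * \<mu>) \<Psi> \<Psi>'"
    using lam assms(5) bes\<Psi> diffV by (intro perturbationI) (auto simp: \<Psi>'(2))
  moreover have "multiplier m \<Phi>' \<Psi>' = multiplier m \<Phi> \<Psi>"
    by (rule ext) (simp add: multiplier_def \<Psi>'(2) DV T'L flip: D_def)
  ultimately show ?thesis using \<Psi>'(1) lam by auto
qed

end
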